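(* Let $d \in \{4,5\}$, and set $\beta := 2^{2^{d-1}}+1$ and $\gamma := \binom{d}{2} 2^{2^{d-1}} + d + 1$. Then every graph $G$ containing $K_{\beta \times \gamma}$ as an induced subgraph satisfies $\dim_{\mathrm{poc}}(G) \ge d+1$.
   Context: Graphs are finite and simple. $K_{m \times n}$ denotes the complete multipartite graph $K_{m,m,\ldots,m}$ with $n$ partite sets, each of size $m$. The competition graph $C(D)$ of a digraph $D$ is the undirected graph with the same vertex set as $D$ in which two distinct vertices $x$ and $y$ are adjacent if and only if there is a vertex $z \in V(D)$ such that $(x,z)$ and $(y,z)$ are both arcs of $D$. For a positive integer $d$ and $x,y \in \mathbb{R}^d$, write $x \prec y$ if $x_i < y_i$ for every $i = 1,\ldots,d$. For a finite subset $S \subseteq \mathbb{R}^d$, let $D_S$ be the digraph with vertex set $S$ and arc set $\{(x,y) \mid x,y \in S,\ y \prec x\}$. A digraph $D$ is called a $d$-partial order if it is isomorphic to $D_S$ for some finite $S \subseteq \mathbb{R}^d$. By convention $\mathbb{R}^0$ is a single point, and a $0$-partial order is a digraph with exactly one vertex. The partial order competition dimension $\dim_{\mathrm{poc}}(G)$ of a graph $G$ is the minimum nonnegative integer $d$ such that $G$ together with sufficiently many isolated vertices is the competition graph of some $d$-partial order: $$\dim_{\mathrm{poc}}(G) := \min\{d \in \mathbb{Z}_{\ge 0} \mid \exists k \in \mathbb{Z}_{\ge 0},\ \exists S \subseteq \mathbb{R}^d \text{ finite such that } G \cup I_k = C(D_S)\},$$ where $I_k$ is a set of $k$ isolated vertices,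 and equality of graphs is understood up to isomorphism. *)

theory Defs
  imports Complex_Main "HOL-Library.FuncSet" "Graph_Theory.Graph_Theory"
begin

text \<open>
  Digraphs without parallel arcs are \<open>pair_pre_digraph\<close>s. As everywhere in \<open>Graph_Theory\<close>, an
  undirected graph is a symmetric digraph; finite simple graphs are characterised by
  \<open>pair_graph\<close>. Isomorphism and induced subgraphs are the library's \<open>digraph_iso\<close> and
  \<open>induced_subgraph\<close>, reached through the coercion \<open>with_proj\<close>.
\<close>

definition complete_multipartite :: "nat \<Rightarrow> nat \<Rightarrow> (nat \<times> nat) pair_pre_digraph" where
  \<comment> \<open>\<open>n\<close> partite sets of size \<open>m\<close>; the vertex \<open>(i, a)\<close> is the \<open>a\<close>-th element of the \<open>i\<close>-th set\<close>
  "complete_multipartite m n =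
    \<lparr>pverts = {..<n} \<times> {..<m},
     parcs = {((i, a), (j, b)) | i a j b. i < n \<and> j < n \<and> a < m \<and> b < m \<and> i \<noteq> j}\<rparr>"

definition contains_induced :: "'a pair_pre_digraph \<Rightarrow> 'b pair_pre_digraph \<Rightarrow> bool" where
  "contains_induced G K \<longleftrightarrow>
    (\<exists>H :: 'a pair_pre_digraph.
      induced_subgraph (with_proj H) (with_proj G) \<and> digraph_iso (with_proj K) (with_proj H))"

definition competition_graph :: "'a pair_pre_digraph \<Rightarrow> 'a pair_pre_digraph" where
  "competition_graph D =
    \<lparr>pverts = pverts D,
     parcs = {(x, y). x \<in> pverts D \<and> y \<in> pverts D \<and> x \<noteq> y \<and>
                (\<exists>z \<in> pverts D. (x, z) \<in> parcs D \<and> (y, z) \<in> parcs D)}\<rparr>"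

definition real_space :: "nat \<Rightarrow> (nat \<Rightarrow> real) set" where
  \<comment> \<open>Coordinates are indexed by \<open>0, \<dots>, d - 1\<close>. The extensional function space ensures that
      different functions are different points; in particular there is exactly one point for
      \<open>d = 0\<close>.\<close>
  "real_space d = {..<d} \<rightarrow>\<^sub>E UNIV"

definition strictly_below :: "nat \<Rightarrow> (nat \<Rightarrow> real) \<Rightarrow> (nat \<Rightarrow> real) \<Rightarrow> bool" where
  "strictly_below d x y \<longleftrightarrow> (\<forall>i<d. x i < y i)"

definition order_digraph :: "nat \<Rightarrow> (nat \<Rightarrow> real) set \<Rightarrow> (nat \<Rightarrow> real) pair_pre_digraph" where
  \<comment> \<open>For \<open>d = 0\<close> the relation is vacuously true and a point gets a loop, which is invisible to
      \<^const>\<open>competition_graph\<close>.\<close>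
  "order_digraph d S =
    \<lparr>pverts = S, parcs = {(x, y). x \<in> S \<and> y \<in> S \<and> strictly_below d y x}\<rparr>"

definition add_isolated :: "'a pair_pre_digraph \<Rightarrow> nat \<Rightarrow> ('a + nat) pair_pre_digraph" where
  "add_isolated G k =
    \<lparr>pverts = pverts G <+> {..<k}, parcs = map_prod Inl Inl ` parcs G\<rparr>"

definition poc_realizable :: "nat \<Rightarrow> 'a pair_pre_digraph \<Rightarrow> bool" where
  "poc_realizable d G \<longleftrightarrow>
    (\<exists>k S. finite S \<and> S \<subseteq> real_space d \<and>
       digraph_iso (with_proj (add_isolated G k))
         (with_proj (competition_graph (order_digraph d S))))"

definition dim_poc :: "'a pair_pre_digraph \<Rightarrow> nat" where
  \<comment> \<open>The minimum exists for every finite simple graph \<open>G\<close>, so the value of \<open>LEAST\<close> is meaningful: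
      with one coordinate per vertex, put the vertex \<open>u\<close> at the point with \<open>0\<close> in coordinate \<open>u\<close>
      and \<open>1\<close> elsewhere, and for every edge \<open>e\<close> add the point with \<open>- 1\<close> in the coordinates of its
      two ends and \<open>0\<close> elsewhere.\<close>
  "dim_poc G = (LEAST d. poc_realizable d G)"

end

theory Submission
  imports Defs
begin

text \<open>
  Suppose that \<open>G\<close>, and with it the complete multipartite graph with \<open>\<gamma>\<close> partite sets of size
  \<open>\<beta>\<close>, is represented by points of \<open>\<real>\<^sup>e\<close> with \<open>e \<le> d\<close>. Call a point below both of two
  vertices a common prey of them: vertices of different partite sets have one, vertices of the same
  set have none.

  A set of more than \<open>2 ^ 2 ^ (e - 1)\<close> points of \<open>\<real>\<^sup>e\<close> contains three distinct ones \<open>x\<close>, \<open>y\<close>, \<open>z\<close> with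
  \<open>y\<close> between \<open>x\<close> and \<open>z\<close> in each coordinate (\<open>between_triple_exists\<close>). So each partite set contains
  such a triple. Let \<open>I\<close> be the set of coordinates in which it increases from \<open>x\<close> to \<open>z\<close>; it
  decreases in the others. Exchanging \<open>x\<close> and \<open>z\<close> replaces \<open>I\<close> by its complement, and of two
  complementary subsets of a set of at most five elements one has at most two elements. Hence
  \<open>card I \<le> 2\<close> can be assumed.

  Let \<open>(x, y, z)\<close> be the triple of a partite set, and \<open>u\<close> a vertex of another one. A common prey \<open>v\<close>
  of \<open>u\<close> and \<open>z\<close> is not below \<open>y\<close>, but \<open>v k < z k \<le> y k\<close> for \<open>k \<notin> I\<close>. So \<open>y k \<le> v k < u k\<close> for some
  \<open>k \<in> I\<close> (\<open>oriented_conflict\<close>). With \<open>u\<close> the first point of the other triple, this has three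
  consequences:
  \<^item> no triple has \<open>I = {}\<close>;
  \<^item> no two triples have the same singleton \<open>I = {i}\<close>, because their intervals \<open>[x i, y i]\<close> would each
    lie to the left of the other;
  \<^item> if several triples have the same \<open>I = {i, j}\<close>, then the rectangles spanned by their \<open>x\<close> and \<open>y\<close>
    in the coordinates \<open>i\<close>, \<open>j\<close> form a descending staircase. If there were more than
    \<open>2 ^ 2 ^ (e - 1)\<close> of them, then the middle point \<open>y\<close> of one triple would be
    between the middle points of two others in each coordinate. A common prey of these two is below
    \<open>y\<close>, and the staircase puts it below the corresponding \<open>x\<close>, too, which is impossible.

  So there are at most \<open>e + (e choose 2) * 2 ^ 2 ^ (e - 1)\<close> partite sets, fewer than \<open>\<gamma>\<close> for
  \<open>e \<le> d\<close>. The bounds increase with \<open>e\<close>, so all \<open>e \<le> d\<close> are excluded by the same argument.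

  The dimension is defined as a least number, and a lower bound for it needs some number in the
  set; \<open>poc_realizable_exists\<close> provides one.
\<close>

section \<open>Triples that are monotone in every coordinate\<close>

definition between :: "nat \<Rightarrow> (nat \<Rightarrow> real) \<Rightarrow> (nat \<Rightarrow> real) \<Rightarrow> (nat \<Rightarrow> real) \<Rightarrow> bool" where
  "between d x y z \<longleftrightarrow> (\<forall>k<d. x k \<le> y k \<and> y k \<le> z k \<or> z k \<le> y k \<and> y k \<le> x k)"

text \<open>
  Order the points by coordinate 0 and colour a pair \<open>s \<sqsubset> t\<close> by the set of the other coordinates that
  do not decrease from \<open>s\<close> to \<open>t\<close>. Two consecutive pairs \<open>s \<sqsubset> t \<sqsubset> u\<close> of the same colour give the
  triple. If there are none, then the colour of a pair \<open>s \<sqsubset> t\<close> starts at \<open>s\<close> but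
  not at \<open>t\<close>, so different points have different sets of starting colours. With \<open>2 ^ (d - 1)\<close> colours
  there are at most \<open>2 ^ 2 ^ (d - 1)\<close> such sets.
\<close>

lemma between_triple_exists:
  fixes f :: "'i::linorder \<Rightarrow> nat \<Rightarrow> real"
  assumes fin: "finite A" and large: "card A > 2 ^ (2 ^ (d - 1))"
  shows "\<exists>s\<in>A. \<exists>t\<in>A. \<exists>u\<in>A. s \<noteq> t \<and> t \<noteq> u \<and> s \<noteq> u \<and> between d (f s) (f t) (f u)"
proof (rule ccontr)
  assume no_triple: "\<not> ?thesis"
  \<comment> \<open>the order of the indices breaks ties, which makes this a total order\<close>
  define prec where "prec s t \<longleftrightarrow> f s 0 < f t 0 \<or> f s 0 = f t 0 \<and> s < t" for s t
  define colour where "colour s t = {k \<in> {1..<d}. f s k \<le> f t k}" for s t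
  define starting where "starting s = {colour s t | t. t \<in> A \<and> prec s t}" for s
  have no_path: "colour s t \<noteq> colour t u"
    if "s \<in> A" "t \<in> A" "u \<in> A" "prec s t" "prec t u" for s t u
  proof
    assume same: "colour s t = colour t u"
    have "between d (f s) (f t) (f u)"
      unfolding between_def
    proof (intro allI impI)
      fix k assume "k < d"
      show "f s k \<le> f t k \<and> f t k \<le> f u k \<or> f u k \<le> f t k \<and> f t k \<le> f s k"
      proof (cases "k = 0")
        case True
        then show ?thesis using that(4,5) by (auto simp: prec_def)
      next
        case False
        then have "f s k \<le> f t k \<longleftrightarrow> f t k \<le> f u k"
          using arg_cong[OF same, of "\<lambda>C. k \<in> C"] \<open>k < d\<close> by (simp add: colour_def)
        then show ?thesis by linarith
      qed
    qed
    moreover have "s \<noteq> t" "t \<noteq> u" "s \<noteq> u"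
      using that(4,5) by (fastforce simp: prec_def)+
    ultimately show False using no_triple that(1-3) by metis
  qed
  have "inj_on starting A"
  proof (rule linorder_inj_onI)
    have distinct: "starting s \<noteq> starting t" if "s \<in> A" "t \<in> A" "prec s t" for s t
    proof -
      have "colour s t \<in> starting s" using that by (auto simp: starting_def)
      moreover have "colour s t \<notin> starting t"
        using no_path[OF that(1,2) _ that(3)] by (auto simp: starting_def)
      ultimately show ?thesis by metis
    qed
    show "starting s \<noteq> starting t" if "s < t" "s \<in> A" "t \<in> A" for s t
      using distinct[of s t] distinct[of t s] that unfolding prec_def by fastforce
  qed auto
  moreover have "starting ` A \<subseteq> Pow (Pow {1..<d})"
    by (auto simp: starting_def colour_def)
  ultimately have "card A \<le> card (Pow (Pow {1..<d}))"
    by (intro card_inj_on_le) auto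
  also have "\<dots> = 2 ^ (2 ^ (d - 1))"
    by (simp add: card_Pow)
  finally show False using large by simp
qed

definition oriented :: "nat \<Rightarrow> nat set \<Rightarrow> (nat \<Rightarrow> real) \<Rightarrow> (nat \<Rightarrow> real) \<Rightarrow> (nat \<Rightarrow> real) \<Rightarrow> bool" where
  "oriented d I x y z \<longleftrightarrow>
    (\<forall>k<d. if k \<in> I then x k \<le> y k \<and> y k \<le> z k else z k \<le> y k \<and> y k \<le> x k)"

lemma orientedD:
  assumes "oriented d I x y z" and "k < d"
  shows "k \<in> I \<Longrightarrow> x k \<le> y k \<and> y k \<le> z k" and "k \<notin> I \<Longrightarrow> z k \<le> y k \<and> y k \<le> x k"
  using assms by (simp_all add: oriented_def)

lemma between_imp_oriented:
  assumes "between d x y z" and "d \<le> 5"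
  shows "\<exists>I \<subseteq> {..<d}. card I \<le> 2 \<and> (oriented d I x y z \<or> oriented d I z y x)"
proof -
  define I where "I = {k \<in> {..<d}. x k \<le> y k \<and> y k \<le> z k}"
  have I: "I \<subseteq> {..<d}" by (auto simp: I_def)
  have "oriented d I x y z" and "oriented d ({..<d} - I) z y x"
    using assms(1) by (auto simp: oriented_def between_def I_def)
  moreover have "card ({..<d} - I) = d - card I"
    using I by (simp add: card_Diff_subset finite_subset)
  then have "card I \<le> 2 \<or> card ({..<d} - I) \<le> 2"
    using assms(2) by linarith
  ultimately show ?thesis using I by (metis Diff_subset)
qed

section \<open>Competition representations of complete multipartite graphs\<close>

definition common_prey :: "nat \<Rightarrow> (nat \<Rightarrow> real) set \<Rightarrow> (nat \<Rightarrow> real) \<Rightarrow> (nat \<Rightarrow> real) \<Rightarrow> bool" where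
  "common_prey d S x y \<longleftrightarrow> (\<exists>v\<in>S. strictly_below d v x \<and> strictly_below d v y)"

lemma oriented_conflict:
  assumes "oriented d I x y z" and "\<not> common_prey d S y z" and "common_prey d S u z"
  shows "\<exists>k\<in>I. y k < u k"
proof -
  obtain v where v: "v \<in> S" "strictly_below d v u" "strictly_below d v z"
    using assms(3) by (auto simp: common_prey_def)
  then have "\<not> strictly_below d v y"
    using assms(2) by (auto simp: common_prey_def)
  then obtain k where k: "k < d" "y k \<le> v k"
    by (auto simp: strictly_below_def not_less)
  have less: "v k < u k" "v k < z k"
    using v(2,3) k(1) by (auto simp: strictly_below_def)
  then have "k \<in> I"
    using orientedD(2)[OF assms(1) k(1)] k(2) by fastforce
  moreover have "y k < u k" using k(2) less(1) by simp
  ultimately show ?thesis by blast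
qed

text \<open>
  One oriented triple for each partite set \<open>t \<in> T\<close>. Only \<open>X\<close> against \<open>Z\<close> and \<open>Y\<close> against \<open>Y\<close> are
  compared between partite sets: the former pairs give the conflicts, the latter the prey that
  violates \<open>same_part\<close>.
\<close>

locale triple_family =
  fixes d :: nat and S :: "(nat \<Rightarrow> real) set" and T :: "nat set"
    and I :: "nat \<Rightarrow> nat set" and X Y Z :: "nat \<Rightarrow> nat \<Rightarrow> real"
  assumes subset: "t \<in> T \<Longrightarrow> I t \<subseteq> {..<d}"
    and oriented: "t \<in> T \<Longrightarrow> oriented d (I t) (X t) (Y t) (Z t)"
    and same_part: "t \<in> T \<Longrightarrow> \<not> common_prey d S (X t) (Y t)" "t \<in> T \<Longrightarrow> \<not> common_prey d S (Y t) (Z t)"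
    and other_part: "\<lbrakk>s \<in> T; t \<in> T; s \<noteq> t\<rbrakk> \<Longrightarrow> common_prey d S (X s) (Z t)"
      "\<lbrakk>s \<in> T; t \<in> T; s \<noteq> t\<rbrakk> \<Longrightarrow> common_prey d S (Y s) (Y t)"
begin

lemma conflict:
  assumes "s \<in> T" "t \<in> T" "s \<noteq> t"
  shows "\<exists>k\<in>I t. Y t k < X s k"
  using oriented_conflict[OF oriented same_part(2) other_part(1)] assms by blast

lemma X_le_Y:
  assumes "t \<in> T" "k \<in> I t"
  shows "X t k \<le> Y t k"
  using orientedD(1)[OF oriented[OF assms(1)]] subset[OF assms(1)] assms(2) by blast

lemma singleton_directions_unique:
  assumes "s \<in> T" "t \<in> T" "I s = {i}" "I t = {i}"
  shows "s = t"
proof (rule ccontr)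
  assume "s \<noteq> t"
  then have "Y t i < X s i" "Y s i < X t i"
    using conflict[of s t] conflict[of t s] assms by auto
  moreover have "X s i \<le> Y s i" "X t i \<le> Y t i"
    using X_le_Y assms by auto
  ultimately show False by linarith
qed

text \<open>
  Let \<open>i\<close> be the coordinate with \<open>Y r i < X s i\<close>. Then the \<open>Y\<close> increase in \<open>i\<close> and, since
  the reverse conflicts cannot be in \<open>i\<close> as well, decrease in \<open>j\<close>. A common prey of \<open>Y r\<close> and
  \<open>Y t\<close> is less than \<open>X s\<close> in \<open>i\<close> because of \<open>Y r\<close>, and in \<open>j\<close> because of \<open>Y t\<close>; in the other
  coordinates it is less than \<open>Y s\<close>, hence than \<open>X s\<close>. So it is a common prey of \<open>X s\<close> and \<open>Y s\<close>.
\<close>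

lemma pair_directions_not_between:
  assumes T: "r \<in> T" "s \<in> T" "t \<in> T" and distinct: "r \<noteq> s" "s \<noteq> t" "r \<noteq> t"
    and I: "I r = {i, j}" "I s = {i, j}" "I t = {i, j}"
  shows "\<not> between d (Y r) (Y s) (Y t)"
proof
  assume btw: "between d (Y r) (Y s) (Y t)"
  \<comment> \<open>for both orders of the pair, since the first conflict can be in either coordinate\<close>
  have staircase: "Y r i' < X s i' \<and> Y t j' < X s j'"
    if pair: "{i', j'} = {i, j}" and first: "Y r i' < X s i'" for i' j'
  proof -
    have I': "I r = {i', j'}" "I s = {i', j'}" "I t = {i', j'}" using I pair by auto
    have less: "i' < d" "j' < d" using subset[OF T(1)] I' by auto
    have le: "X q k \<le> Y q k" if "q \<in> {r, s, t}" "k \<in> {i', j'}" for q k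
      using X_le_Y T I' that by auto
    have btw': "Y r k \<le> Y s k \<and> Y s k \<le> Y t k \<or> Y t k \<le> Y s k \<and> Y s k \<le> Y r k"
      if "k \<in> {i', j'}" for k using btw less that by (auto simp: between_def)
    have "Y r i' < Y s i'" using first le[of s i'] by auto
    then have "Y s i' \<le> Y t i'" using btw'[of i'] by auto
    moreover have "Y s j' < X r j'"
      using conflict[of r s] T distinct I' le[of r i'] \<open>Y r i' < Y s i'\<close> by auto
    then have "Y s j' < Y r j'" using le[of r j'] by auto
    ultimately have "Y t j' < X s j'"
      using conflict[of s t] T distinct I' le[of s i'] by auto
    then show ?thesis using first by blast
  qed
  have "Y r i < X s i \<or> Y r j < X s j"
    using conflict[of s r] T distinct I by auto
  then have left: "\<forall>k\<in>{i, j}. Y r k < X s k \<or> Y t k < X s k"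
    using staircase[of i j] staircase[of j i] by (auto simp: insert_commute)
  obtain v where v: "v \<in> S" "strictly_below d v (Y r)" "strictly_below d v (Y t)"
    using other_part(2)[of r t] T distinct by (auto simp: common_prey_def)
  have "strictly_below d v (Y s)"
    unfolding strictly_below_def
  proof (intro allI impI)
    fix k assume "k < d"
    then have "v k < Y r k" "v k < Y t k" "Y r k \<le> Y s k \<or> Y t k \<le> Y s k"
      using v(2,3) btw by (auto simp: strictly_below_def between_def)
    then show "v k < Y s k" by linarith
  qed
  moreover have "strictly_below d v (X s)"
    unfolding strictly_below_def
  proof (intro allI impI)
    fix k assume k: "k < d"
    have "v k < Y r k" "v k < Y t k" "v k < Y s k"
      using v(2,3) \<open>strictly_below d v (Y s)\<close> k by (auto simp: strictly_below_def)
    then show "v k < X s k"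
      using left orientedD(2)[OF oriented[OF T(2)] k] I(2)
      by (cases "k \<in> {i, j}") fastforce+
  qed
  ultimately show False
    using same_part(1)[OF T(2)] v(1) by (auto simp: common_prey_def)
qed

lemma directions_nonempty:
  assumes "s \<in> T" "t \<in> T" "s \<noteq> t"
  shows "I t \<noteq> {}"
  using conflict[OF assms] by blast

lemma card_le:
  assumes fin: "finite T" and two: "card T \<ge> 2" and small: "\<And>t. t \<in> T \<Longrightarrow> card (I t) \<le> 2"
  shows "card T \<le> d + (d choose 2) * 2 ^ (2 ^ (d - 1))"
proof -
  define F where "F J = {t \<in> T. I t = J}" for J
  define L where "L r = {J. J \<subseteq> {..<d} \<and> card J = r}" for r
  have fin_L: "finite (L r)" for r by (auto simp: L_def)
  have card_L: "card (L r) = d choose r" for r by (simp add: L_def n_subsets)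
  have cover: "T \<subseteq> (\<Union>J\<in>L 1. F J) \<union> (\<Union>J\<in>L 2. F J)"
  proof
    fix t assume t: "t \<in> T"
    have "T \<noteq> {t}" using two by auto
    then obtain s where "s \<in> T" "s \<noteq> t" using t by blast
    then have "I t \<noteq> {}" using directions_nonempty t by blast
    moreover have "finite (I t)" using subset[OF t] finite_subset by blast
    ultimately have "card (I t) = 1 \<or> card (I t) = 2"
      using small[OF t] by (metis card_0_eq le_SucE le_zero_eq numeral_2_eq_2 One_nat_def)
    then show "t \<in> (\<Union>J\<in>L 1. F J) \<union> (\<Union>J\<in>L 2. F J)"
      using t subset[OF t] by (auto simp: F_def L_def)
  qed
  have singles: "card (F J) \<le> 1" if "J \<in> L 1" for J
  proof -
    have "card J = 1" using that by (simp add: L_def)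
    then obtain i where "J = {i}" by (rule card_1_singletonE)
    then have "\<forall>s\<in>F J. \<forall>t\<in>F J. s = t"
      using singleton_directions_unique by (auto simp: F_def)
    then show ?thesis
      using fin by (auto simp: F_def card_le_Suc0_iff_eq)
  qed
  have pairs: "card (F J) \<le> 2 ^ (2 ^ (d - 1))" if "J \<in> L 2" for J
  proof (rule ccontr)
    assume "\<not> card (F J) \<le> 2 ^ (2 ^ (d - 1))"
    then obtain r s t where rst: "r \<in> F J" "s \<in> F J" "t \<in> F J" "r \<noteq> s" "s \<noteq> t" "r \<noteq> t"
        "between d (Y r) (Y s) (Y t)"
      using between_triple_exists[of "F J" d Y] fin by (auto simp: F_def not_le)
    have "card J = 2" using that by (simp add: L_def)
    then obtain i j where "J = {i, j}" by (metis card_2_iff)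
    then show False
      using pair_directions_not_between[of r s t i j] rst by (auto simp: F_def)
  qed
  have "card T \<le> card ((\<Union>J\<in>L 1. F J) \<union> (\<Union>J\<in>L 2. F J))"
    using cover fin fin_L by (intro card_mono) (auto simp: F_def)
  also have "\<dots> \<le> card (\<Union>J\<in>L 1. F J) + card (\<Union>J\<in>L 2. F J)"
    by (rule card_Un_le)
  also have "\<dots> \<le> (\<Sum>J\<in>L 1. card (F J)) + (\<Sum>J\<in>L 2. card (F J))"
    by (intro add_mono card_UN_le fin_L)
  also have "\<dots> \<le> of_nat (card (L 1)) * 1 + of_nat (card (L 2)) * 2 ^ (2 ^ (d - 1))"
    by (intro add_mono sum_bounded_above singles pairs)
  also have "\<dots> = d + (d choose 2) * 2 ^ (2 ^ (d - 1))"
    unfolding card_L by simp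
  finally show ?thesis .
qed

end

lemma multipartite_representation_card:
  fixes p :: "nat \<Rightarrow> nat \<Rightarrow> nat \<Rightarrow> real"
  assumes d: "d \<le> 5" and m: "m > 2 ^ (2 ^ (d - 1))" and n: "n \<ge> 2"
    and same: "\<And>t a b. \<lbrakk>t < n; a < m; b < m; a \<noteq> b\<rbrakk> \<Longrightarrow> \<not> common_prey d S (p t a) (p t b)"
    and other: "\<And>s t a b. \<lbrakk>s < n; t < n; s \<noteq> t; a < m; b < m\<rbrakk> \<Longrightarrow> common_prey d S (p s a) (p t b)"
  shows "n \<le> d + (d choose 2) * 2 ^ (2 ^ (d - 1))"
proof -
  have "\<exists>I a b c. a < m \<and> b < m \<and> c < m \<and> a \<noteq> b \<and> b \<noteq> c \<and> I \<subseteq> {..<d} \<and> card I \<le> 2 \<and>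
      oriented d I (p t a) (p t b) (p t c)" for t
  proof -
    obtain a b c where abc: "a < m" "b < m" "c < m" "a \<noteq> b" "b \<noteq> c"
        and btw: "between d (p t a) (p t b) (p t c)"
      using between_triple_exists[of "{..<m}" d "p t"] m by auto
    obtain I where "I \<subseteq> {..<d}" "card I \<le> 2"
        "oriented d I (p t a) (p t b) (p t c) \<or> oriented d I (p t c) (p t b) (p t a)"
      using between_imp_oriented[OF btw d] by blast
    then show ?thesis using abc by metis
  qed
  then obtain I a b c where abc: "\<And>t. a t < m" "\<And>t. b t < m" "\<And>t. c t < m"
      "\<And>t. a t \<noteq> b t" "\<And>t. b t \<noteq> c t"
    and I: "\<And>t. I t \<subseteq> {..<d}" "\<And>t. card (I t) \<le> 2"
      "\<And>t. oriented d (I t) (p t (a t)) (p t (b t)) (p t (c t))"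
    by metis
  interpret triple_family d S "{..<n}" I
    "\<lambda>t. p t (a t)" "\<lambda>t. p t (b t)" "\<lambda>t. p t (c t)"
    by unfold_locales (use abc I same other in auto)
  show ?thesis using card_le I(2) n by simp
qed

section \<open>Isomorphisms and induced subgraphs\<close>

text \<open>
  Tail and head of an arc are its components in both digraphs, so the arc map of an isomorphism is
  determined by the vertex map.
\<close>

lemma pair_digraph_isoE:
  assumes "digraph_iso (with_proj G) (with_proj H)"
  obtains f where "inj_on f (pverts G)" "pverts H = f ` pverts G" "parcs H = map_prod f f ` parcs G"
    "parcs G \<subseteq> pverts G \<times> pverts G"
proof -
  obtain h where h: "pre_digraph.digraph_isomorphism (with_proj G) h"
      and H: "with_proj H = app_iso h (with_proj G)"
    using assms by (auto simp: digraph_iso_def)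
  have "verts (with_proj H) = iso_verts h ` verts (with_proj G)"
      "arcs (with_proj H) = iso_arcs h ` arcs (with_proj G)"
      "tail (with_proj H) = iso_tail h" "head (with_proj H) = iso_head h"
    unfolding H by simp_all
  then have H': "pverts H = iso_verts h ` pverts G" "parcs H = iso_arcs h ` parcs G"
      "iso_tail h = fst" "iso_head h = snd"
    by simp_all
  have arcs: "iso_arcs h a = map_prod (iso_verts h) (iso_verts h) a" if "a \<in> parcs G" for a
    using h H'(3,4) that by (auto simp: pre_digraph.digraph_isomorphism_def prod_eq_iff)
  have wf: "pair_wf_digraph G"
    using h by (simp add: pre_digraph.digraph_isomorphism_def wf_digraph_wp_iff)
  show thesis
  proof
    show "inj_on (iso_verts h) (pverts G)"
      using h by (simp add: pre_digraph.digraph_isomorphism_def)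
    show "pverts H = iso_verts h ` pverts G" by fact
    show "parcs H = map_prod (iso_verts h) (iso_verts h) ` parcs G"
      unfolding H'(2) by (intro image_cong arcs refl)
    show "parcs G \<subseteq> pverts G \<times> pverts G"
      using wf by (auto simp: pair_wf_digraph_def)
  qed
qed

lemma pair_digraph_isoI:
  assumes wf: "parcs G \<subseteq> pverts G \<times> pverts G"
    and inj: "inj_on f (pverts G)"
    and verts: "pverts H = f ` pverts G" and arcs: "parcs H = map_prod f f ` parcs G"
  shows "digraph_iso (with_proj G) (with_proj H)"
proof -
  let ?h = "\<lparr>iso_verts = f, iso_arcs = map_prod f f, iso_head = snd, iso_tail = fst\<rparr>"
  have "wf_digraph (with_proj G)"
    using wf by (auto simp: wf_digraph_wp_iff pair_wf_digraph_def)
  moreover have "inj_on (map_prod f f) (parcs G)"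
    using map_prod_inj_on[OF inj inj] wf by (rule inj_on_subset)
  ultimately have "pre_digraph.digraph_isomorphism (with_proj G) ?h"
    using inj by (simp add: pre_digraph.digraph_isomorphism_def)
  moreover have "with_proj H = app_iso ?h (with_proj G)"
    using verts arcs by (simp add: with_proj_def app_iso_def)
  ultimately show ?thesis by (auto simp: digraph_iso_def)
qed

lemma map_prod_arc_iff:
  assumes "inj_on f V" "A \<subseteq> V \<times> V" "x \<in> V" "y \<in> V"
  shows "(f x, f y) \<in> map_prod f f ` A \<longleftrightarrow> (x, y) \<in> A"
proof
  assume "(f x, f y) \<in> map_prod f f ` A"
  then obtain a b where ab: "(a, b) \<in> A" "f x = f a" "f y = f b" by auto
  then have "a \<in> V" "b \<in> V" using assms(2) by auto
  then have "x = a" "y = b" using ab(2,3) assms(1,3,4) by (simp_all add: inj_on_eq_iff)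
  then show "(x, y) \<in> A" using ab(1) by simp
qed force

lemma contains_inducedE:
  assumes "contains_induced G K"
  obtains f where "inj_on f (pverts K)" "f ` pverts K \<subseteq> pverts G"
    "\<And>x y. \<lbrakk>x \<in> pverts K; y \<in> pverts K\<rbrakk> \<Longrightarrow> (f x, f y) \<in> parcs G \<longleftrightarrow> (x, y) \<in> parcs K"
proof -
  obtain H :: "'a pair_pre_digraph" where ind: "induced_subgraph (with_proj H) (with_proj G)"
      and iso: "digraph_iso (with_proj K) (with_proj H)"
    using assms by (auto simp: contains_induced_def)
  obtain f where f: "inj_on f (pverts K)" "pverts H = f ` pverts K"
      "parcs H = map_prod f f ` parcs K" "parcs K \<subseteq> pverts K \<times> pverts K"
    using iso by (rule pair_digraph_isoE)
  have sub: "pverts H \<subseteq> pverts G"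
      "parcs H = {e \<in> parcs G. fst e \<in> pverts H \<and> snd e \<in> pverts H}"
    using ind by (auto simp: induced_subgraph_def subgraph_def)
  show thesis
  proof
    show "inj_on f (pverts K)" by fact
    show "f ` pverts K \<subseteq> pverts G" using f(2) sub(1) by simp
    fix x y assume xy: "x \<in> pverts K" "y \<in> pverts K"
    then have "(f x, f y) \<in> parcs G \<longleftrightarrow> (f x, f y) \<in> parcs H"
      using sub(2) f(2) by simp
    then show "(f x, f y) \<in> parcs G \<longleftrightarrow> (x, y) \<in> parcs K"
      using map_prod_arc_iff[OF f(1,4) xy] f(3) by simp
  qed
qed

lemma poc_realizableE:
  assumes "poc_realizable d G"
  obtains S g where
    "\<And>x y. \<lbrakk>x \<in> pverts G; y \<in> pverts G; x \<noteq> y\<rbrakk> \<Longrightarrow> (x, y) \<in> parcs G \<longleftrightarrow> common_prey d S (g x) (g y)"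
proof -
  obtain k S where "digraph_iso (with_proj (add_isolated G k))
      (with_proj (competition_graph (order_digraph d S)))"
    using assms by (auto simp: poc_realizable_def)
  then obtain f where f: "inj_on f (pverts (add_isolated G k))"
      "pverts (competition_graph (order_digraph d S)) = f ` pverts (add_isolated G k)"
      "parcs (competition_graph (order_digraph d S)) = map_prod f f ` parcs (add_isolated G k)"
      "parcs (add_isolated G k) \<subseteq> pverts (add_isolated G k) \<times> pverts (add_isolated G k)"
    by (rule pair_digraph_isoE)
  have Inl: "Inl x \<in> pverts (add_isolated G k)" if "x \<in> pverts G" for x
    using that by (auto simp: add_isolated_def)
  have S: "f (Inl x) \<in> S" if "x \<in> pverts G" for x
    using f(2) Inl[OF that] by (auto simp: competition_graph_def order_digraph_def)
  show thesis
  proof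
    fix x y assume xy: "x \<in> pverts G" "y \<in> pverts G" "x \<noteq> y"
    then have neq: "f (Inl x) \<noteq> f (Inl y)"
      using f(1) Inl by (simp add: inj_on_eq_iff)
    have "(x, y) \<in> parcs G \<longleftrightarrow> (Inl x, Inl y) \<in> parcs (add_isolated G k)"
      by (auto simp: add_isolated_def)
    also have "\<dots> \<longleftrightarrow> (f (Inl x), f (Inl y)) \<in> parcs (competition_graph (order_digraph d S))"
      using map_prod_arc_iff[OF f(1,4) Inl[OF xy(1)] Inl[OF xy(2)]] f(3) by simp
    also have "\<dots> \<longleftrightarrow> common_prey d S (f (Inl x)) (f (Inl y))"
      using S[OF xy(1)] S[OF xy(2)] neq
      by (auto simp: competition_graph_def order_digraph_def common_prey_def)
    finally show "(x, y) \<in> parcs G \<longleftrightarrow> common_prey d S ((f \<circ> Inl) x) ((f \<circ> Inl) y)" by simp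
  qed
qed

lemma not_poc_realizable_if_contains_multipartite:
  assumes d: "d \<le> 5" and m: "m > 2 ^ (2 ^ (d - 1))"
    and n: "n \<ge> 2" "n > d + (d choose 2) * 2 ^ (2 ^ (d - 1))"
    and sub: "contains_induced G (complete_multipartite m n)"
  shows "\<not> poc_realizable d G"
proof
  assume "poc_realizable d G"
  then obtain S g where
    g: "\<And>x y. \<lbrakk>x \<in> pverts G; y \<in> pverts G; x \<noteq> y\<rbrakk> \<Longrightarrow> (x, y) \<in> parcs G \<longleftrightarrow> common_prey d S (g x) (g y)"
    by (rule poc_realizableE) blast
  let ?K = "complete_multipartite m n"
  obtain f where f: "inj_on f (pverts ?K)" "f ` pverts ?K \<subseteq> pverts G"
      "\<And>x y. \<lbrakk>x \<in> pverts ?K; y \<in> pverts ?K\<rbrakk> \<Longrightarrow> (f x, f y) \<in> parcs G \<longleftrightarrow> (x, y) \<in> parcs ?K"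
    using sub by (rule contains_inducedE) blast
  define p where "p t a = g (f (t, a))" for t a
  have K: "(t, a) \<in> pverts ?K \<longleftrightarrow> t < n \<and> a < m" for t a
    by (simp add: complete_multipartite_def)
  have prey: "common_prey d S (p s a) (p t b) \<longleftrightarrow> s \<noteq> t"
    if "s < n" "t < n" "a < m" "b < m" "(s, a) \<noteq> (t, b)" for s t a b
  proof -
    have in_K: "(s, a) \<in> pverts ?K" "(t, b) \<in> pverts ?K" using that K by auto
    have "f (s, a) \<noteq> f (t, b)" using f(1) in_K that(5) by (meson inj_onD)
    then have "common_prey d S (p s a) (p t b) \<longleftrightarrow> (f (s, a), f (t, b)) \<in> parcs G"
      unfolding p_def using g f(2) in_K by blast
    also have "\<dots> \<longleftrightarrow> ((s, a), (t, b)) \<in> parcs ?K" using f(3) in_K by blast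
    also have "\<dots> \<longleftrightarrow> s \<noteq> t" using that by (auto simp: complete_multipartite_def)
    finally show ?thesis .
  qed
  have "n \<le> d + (d choose 2) * 2 ^ (2 ^ (d - 1))"
    by (rule multipartite_representation_card[OF d m n(1), of S p]) (use prey in auto)
  then show False using n(2) by simp
qed

section \<open>Every finite graph has a realization\<close>

text \<open>
  One coordinate per vertex: the point of a vertex is 0 in its own coordinate and 1
  elsewhere; the point of an edge is -1 in the coordinates of its ends and 0 elsewhere. An edge point
  is below a vertex point iff the vertex is an end of the edge, and no other point is below another
  one. So two points have a common prey iff they belong to the ends of an edge, and the edge points
  become the additional isolated vertices.
\<close>

lemma poc_realizable_exists:
  assumes "pair_graph G"
  shows "\<exists>d. poc_realizable d G"
proof -
  interpret pair_graph G by fact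
  define n where "n = card (pverts G)"
  obtain num where num: "bij_betw num (pverts G) {..<n}"
    using ex_bij_betw_finite_nat[OF pair_finite_verts] by (auto simp: n_def atLeast0LessThan)
  define E where "E = (\<lambda>(x, y). {num x, num y}) ` parcs G"
  have "finite E" using pair_finite_arcs by (simp add: E_def)
  then obtain edge where edge: "bij_betw edge {..<card E} E"
    using ex_bij_betw_nat_finite by (auto simp: atLeast0LessThan)
  define vpoint :: "nat \<Rightarrow> nat \<Rightarrow> real"
    where "vpoint u = restrict (\<lambda>k. if k = u then 0 else 1) {..<n}" for u
  define epoint :: "nat set \<Rightarrow> nat \<Rightarrow> real"
    where "epoint e = restrict (\<lambda>k. if k \<in> e then -1 else 0) {..<n}" for e
  have num_less: "num x < n" if "x \<in> pverts G" for x
    using num that by (auto simp: bij_betw_def)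
  have num_eq: "num x = num y \<longleftrightarrow> x = y" if "x \<in> pverts G" "y \<in> pverts G" for x y
    using num that by (auto simp: bij_betw_def inj_on_def)
  have arc_verts: "x \<in> pverts G \<and> y \<in> pverts G \<and> x \<noteq> y" if "(x, y) \<in> parcs G" for x y
    using that wellformed' pair_no_loops by (metis fst_conv snd_conv)
  have E_sub: "e \<subseteq> {..<n} \<and> e \<noteq> {}" if "e \<in> E" for e
    using that arc_verts num_less by (force simp: E_def)
  have E_iff: "(\<exists>e\<in>E. num x \<in> e \<and> num y \<in> e) \<longleftrightarrow> (x, y) \<in> parcs G"
    if "x \<in> pverts G" "y \<in> pverts G" "x \<noteq> y" for x y
  proof
    assume "\<exists>e\<in>E. num x \<in> e \<and> num y \<in> e"
    then obtain a b where ab: "(a, b) \<in> parcs G" "num x \<in> {num a, num b}" "num y \<in> {num a, num b}"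
      by (auto simp: E_def)
    then have "x = a \<and> y = b \<or> x = b \<and> y = a"
      using that arc_verts[OF ab(1)] num_eq by auto
    then show "(x, y) \<in> parcs G" using ab(1) arcs_symmetric by auto
  next
    assume "(x, y) \<in> parcs G"
    then show "\<exists>e\<in>E. num x \<in> e \<and> num y \<in> e" by (force simp: E_def)
  qed
  define S where "S = vpoint ` {..<n} \<union> epoint ` E"
  have below_v: "strictly_below n s (vpoint u) \<longleftrightarrow> (\<exists>e\<in>E. s = epoint e \<and> u \<in> e)"
    if "s \<in> S" "u < n" for s u
  proof
    assume b: "strictly_below n s (vpoint u)"
    then have "s u < 0" using that(2) by (auto simp: strictly_below_def vpoint_def)
    then show "\<exists>e\<in>E. s = epoint e \<and> u \<in> e"
      using that by (auto simp: S_def vpoint_def epoint_def split: if_splits)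
  next
    assume "\<exists>e\<in>E. s = epoint e \<and> u \<in> e"
    then show "strictly_below n s (vpoint u)"
      by (auto simp: strictly_below_def epoint_def vpoint_def)
  qed
  have below_e: "\<not> strictly_below n s (epoint e)" if s: "s \<in> S" and e: "e \<in> E" for s e
  proof
    assume b: "strictly_below n s (epoint e)"
    obtain k where k: "k \<in> e" "k < n" using E_sub[OF e] by auto
    then have "s k < -1" using b by (auto simp: strictly_below_def epoint_def)
    then show False using s k(2)
      by (auto simp: S_def vpoint_def epoint_def split: if_splits)
  qed
  have inj_v: "vpoint u = vpoint w \<longleftrightarrow> u = w" if "u < n" "w < n" for u w
    using that by (auto simp: vpoint_def fun_eq_iff restrict_def split: if_splits)
  have inj_e: "epoint e = epoint e' \<longleftrightarrow> e = e'" if "e \<in> E" "e' \<in> E" for e e'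
  proof
    assume eq: "epoint e = epoint e'"
    have "k \<in> e \<longleftrightarrow> k \<in> e'" if "k < n" for k
      using fun_cong[OF eq, of k] that by (auto simp: epoint_def split: if_splits)
    then show "e = e'" using E_sub[OF \<open>e \<in> E\<close>] E_sub[OF \<open>e' \<in> E\<close>] by blast
  qed simp
  have ve: "vpoint u \<noteq> epoint e" if e: "e \<in> E" for u e
  proof
    assume eq: "vpoint u = epoint e"
    obtain k where "k \<in> e" "k < n" using E_sub[OF e] by auto
    then show False using fun_cong[OF eq, of k] by (auto simp: vpoint_def epoint_def split: if_splits)
  qed
  define h where "h = case_sum (\<lambda>x. vpoint (num x)) (\<lambda>i. epoint (edge i))"
  have edge_in: "edge i \<in> E" if "i < card E" for i
    using edge that by (auto simp: bij_betw_def)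
  have edge_eq: "edge i = edge j \<longleftrightarrow> i = j" if "i < card E" "j < card E" for i j
    using edge that by (auto simp: bij_betw_def inj_on_def)
  let ?A = "add_isolated G (card E)" and ?C = "competition_graph (order_digraph n S)"
  have S_image: "S = h ` pverts ?A"
  proof -
    have "num ` pverts G = {..<n}" "edge ` {..<card E} = E"
      using num edge by (auto simp: bij_betw_def)
    then have "S = (\<lambda>x. vpoint (num x)) ` pverts G \<union> (\<lambda>i. epoint (edge i)) ` {..<card E}"
      unfolding S_def by (metis image_image)
    then show ?thesis
      by (simp add: add_isolated_def h_def Plus_def image_Un image_image)
  qed
  have arc: "(h x, h y) \<in> parcs ?C \<longleftrightarrow> (x, y) \<in> parcs ?A"
    if x: "x \<in> pverts ?A" and y: "y \<in> pverts ?A" and neq: "h x \<noteq> h y" for x y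
  proof -
    have in_S: "h x \<in> S" "h y \<in> S" using x y S_image by auto
    then have C: "(h x, h y) \<in> parcs ?C \<longleftrightarrow>
        (\<exists>s\<in>S. strictly_below n s (h x) \<and> strictly_below n s (h y))"
      using neq by (auto simp: competition_graph_def order_digraph_def)
    show ?thesis
    proof (cases "\<exists>a\<in>pverts G. \<exists>b\<in>pverts G. x = Inl a \<and> y = Inl b")
      case True
      then obtain a b where ab: "a \<in> pverts G" "b \<in> pverts G" "x = Inl a" "y = Inl b" by blast
      have "(h x, h y) \<in> parcs ?C \<longleftrightarrow> (\<exists>e\<in>E. num a \<in> e \<and> num b \<in> e)"
      proof
        assume "(h x, h y) \<in> parcs ?C"
        then obtain s where s: "s \<in> S" "strictly_below n s (vpoint (num a))"
            "strictly_below n s (vpoint (num b))"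
          unfolding C by (auto simp: ab h_def)
        then obtain e e' where e: "e \<in> E" "s = epoint e" "num a \<in> e"
            and e': "e' \<in> E" "s = epoint e'" "num b \<in> e'"
          using below_v num_less ab(1,2) by meson
        then have "e = e'" using inj_e[of e e'] by simp
        then show "\<exists>e\<in>E. num a \<in> e \<and> num b \<in> e" using e e' by blast
      next
        assume "\<exists>e\<in>E. num a \<in> e \<and> num b \<in> e"
        then obtain e where e: "e \<in> E" "num a \<in> e" "num b \<in> e" by blast
        then have "epoint e \<in> S" by (auto simp: S_def)
        then show "(h x, h y) \<in> parcs ?C"
          unfolding C using e below_v num_less ab(1,2) by (auto simp: ab h_def)
      qed
      also have "\<dots> \<longleftrightarrow> (a, b) \<in> parcs G"
        using E_iff[OF ab(1,2)] neq ab by auto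
      also have "\<dots> \<longleftrightarrow> (x, y) \<in> parcs ?A"
        by (auto simp: add_isolated_def ab)
      finally show ?thesis .
    next
      case False
      then have "(\<exists>i<card E. x = Inr i) \<or> (\<exists>i<card E. y = Inr i)"
        using x y by (auto simp: add_isolated_def)
      then have "(h x, h y) \<notin> parcs ?C"
        unfolding C using below_e edge_in by (auto simp: h_def)
      moreover have "(x, y) \<notin> parcs ?A"
        using False arc_verts by (auto simp: add_isolated_def)
      ultimately show ?thesis by blast
    qed
  qed
  have inj_h: "inj_on h (pverts ?A)"
  proof (rule inj_onI)
    fix x y assume "x \<in> pverts ?A" "y \<in> pverts ?A" "h x = h y"
    then show "x = y"
      using inj_v num_less num_eq inj_e edge_in edge_eq ve ve[symmetric]
      by (auto simp: add_isolated_def h_def)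
  qed
  have wf_A: "parcs ?A \<subseteq> pverts ?A \<times> pverts ?A"
    using arc_verts by (auto simp: add_isolated_def)
  have irrefl_A: "x \<noteq> y" if "(x, y) \<in> parcs ?A" for x y
    using that arc_verts by (auto simp: add_isolated_def)
  have "parcs ?C = map_prod h h ` parcs ?A"
  proof (intro set_eqI iffI)
    fix q assume q: "q \<in> parcs ?C"
    then have q_S: "fst q \<in> h ` pverts ?A" "snd q \<in> h ` pverts ?A" and neq: "fst q \<noteq> snd q"
      unfolding S_image[symmetric] by (auto simp: competition_graph_def order_digraph_def)
    obtain x where x: "x \<in> pverts ?A" "fst q = h x" using q_S(1) by (rule imageE)
    obtain y where y: "y \<in> pverts ?A" "snd q = h y" using q_S(2) by (rule imageE)
    have q_eq: "q = map_prod h h (x, y)" using x(2) y(2) by (simp add: prod_eq_iff)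
    have "(x, y) \<in> parcs ?A" using arc[OF x(1) y(1)] q q_eq neq by simp
    then show "q \<in> map_prod h h ` parcs ?A" unfolding q_eq by (rule imageI)
  next
    fix q assume "q \<in> map_prod h h ` parcs ?A"
    then obtain x y where xy: "(x, y) \<in> parcs ?A" "q = (h x, h y)" by auto
    then have "x \<in> pverts ?A" "y \<in> pverts ?A" using wf_A by auto
    then show "q \<in> parcs ?C"
      using arc[of x y] xy irrefl_A inj_h by (auto dest: inj_onD)
  qed
  moreover have "pverts ?C = h ` pverts ?A"
    using S_image by (simp add: competition_graph_def order_digraph_def)
  ultimately have "digraph_iso (with_proj ?A) (with_proj ?C)"
    using pair_digraph_isoI[OF wf_A inj_h] by blast
  moreover have "finite S" using \<open>finite E\<close> by (simp add: S_def)
  moreover have "S \<subseteq> real_space n"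
    by (auto simp: S_def real_space_def vpoint_def epoint_def split: if_splits)
  ultimately show ?thesis unfolding poc_realizable_def by blast
qed

section \<open>The lower bound\<close>

theorem theorem3p5:
  fixes G :: "'a pair_pre_digraph" and d \<beta> \<gamma> :: nat
  assumes "d \<in> {4, 5}"
    and "\<beta> = 2 ^ (2 ^ (d - 1)) + 1"
    and "\<gamma> = (d choose 2) * 2 ^ (2 ^ (d - 1)) + d + 1"
    and "pair_graph G"
    and "contains_induced G (complete_multipartite \<beta> \<gamma>)"
  shows "dim_poc G \<ge> d + 1"
proof -
  have "poc_realizable (dim_poc G) G"
    unfolding dim_poc_def using poc_realizable_exists[OF assms(4)] by (rule LeastI_ex)
  moreover have "\<not> poc_realizable e G" if "e \<le> d" for e
  proof -
    have power: "(2::nat) ^ (2 ^ (e - 1)) \<le> 2 ^ (2 ^ (d - 1))"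
      using that by (intro power_increasing) auto
    have "e choose 2 \<le> d choose 2"
      using that by (rule binomial_right_mono)
    then have "e + (e choose 2) * 2 ^ (2 ^ (e - 1)) \<le> d + (d choose 2) * 2 ^ (2 ^ (d - 1))"
      using power that by (intro add_mono mult_mono) auto
    then have "e + (e choose 2) * 2 ^ (2 ^ (e - 1)) < \<gamma>" "2 \<le> \<gamma>"
      using assms(1,3) by auto
    moreover have "e \<le> 5"
      using that assms(1) by auto
    moreover have "2 ^ (2 ^ (e - 1)) < \<beta>"
      unfolding assms(2) using power by linarith
    ultimately show ?thesis
      using not_poc_realizable_if_contains_multipartite assms(5) by blast
  qed
  ultimately show ?thesis by (metis Suc_eq_plus1 not_less_eq_eq)
qed

end
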